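(* Let $n\ge2$ and consider an $n$-asset AMM such that, for every valid state $p\in\mathcal S$ and every pair $1\le i<j\le n$, the two-token $(i,j)$ restriction through $p$, viewed in the coordinates $(x_i,x_j)$, satisfies the two-asset axioms (validity invariance, Pareto efficiency, and unit invariance). Suppose additionally that the orbit structure is invariant under every permutation of tokens: for every permutation $\sigma$ of $\{1,\dots,n\}$ and all $s,t\in\mathcal S$, $s\sim t\iff \sigma(s)\sim\sigma(t)$, where $\sigma(s)$ is the state $(x_{\sigma(1)},\dots,x_{\sigma(n)})$ for $s=(x_1,\dots,x_n)$. Let $w_1,\dots,w_n>0$ with $\sum_iw_i=1$ be weights such that the trading orbits in $\mathcal S$ are exactly the level sets of $\prod_i x_i^{w_i}$ (such weights exist under the assumption on the two-token restrictions). Then $w_i=1/n$ for all $i$, and $\prod_{i=1}^n x_i$ is constant on every trading orbit.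
   Context: A state is a vector $s=(x_1,\dots,x_n)\in\mathbb R^n$; the valid state space is $\mathcal S=\{s\in\mathbb R^n: x_i>0\text{ for all }i\}$. An $n$-asset AMM consists, for each ordered pair of distinct tokens $(i,j)$, of a swap primitive $X_{ij}:\mathbb R^n\times[0,\infty)\to\mathbb R^n$, where $X_{ij}(s,dx)$ is obtained from $s$ by replacing $(x_i,x_j)$ with $(x_i+dx,\;x_j-y^{ij}_{\mathrm{out}}(s,dx))$ and leaving all other coordinates unchanged; $y^{ij}_{\mathrm{out}}:\mathbb R^n\times[0,\infty)\to\mathbb R$ is an arbitrary function. Adjacency: $s\leftrightarrow t$ if there are $i\neq j$ and $\delta\ge0$ with $t=X_{ij}(s,\delta)$ or $s=X_{ij}(t,\delta)$. Orbit relation: $s\sim t$ if $s$ and $t$ are joined by a finite (possibly zero-length) chain of adjacent states in $\mathbb R^n$. The trading orbit of $s\in\mathcal S$ is $[s]=\{t\in\mathcal S:t\sim s\}$. For $p\in\mathcal S$ and $i<j$, the coordinate slice is $\Pi_{ij}(p)=\{x\in\mathbb R^n: x_k=p_k\text{ for all }k\ne i,j\}$. The two-token $(i,j)$ restriction through $p$ is the two-asset AMM on $\Pi_{ij}(p)$ (with coordinates $(x_i,x_j)$) whose swap primitives are $X_{ij}$ and $X_{ji}$ restricted to $\Pi_{ij}(p)$, and whose trading orbits are the intersections of the global trading orbits with the slice: the orbit through $p$ is $[p]_{ij}=[p]\cap\Pi_{ij}(p)$, and likewise $[q]\cap\Pi_{ij}(p)$ for any valid $q\in\Pi_{ij}(p)$.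 The restriction satisfies the two-asset axioms when: Validity invariance: for every $s\in\Pi_{ij}(p)$ and $\delta\ge0$, $X_{ij}(s,\delta)\in\mathcal S\iff s\in\mathcal S$, and $X_{ji}(s,\delta)\in\mathcal S\iff s\in\mathcal S$. Pareto efficiency: for all valid $s,t\in\Pi_{ij}(p)\cap\mathcal S$ in the same trading orbit (i.e. $s\sim t$ for the global orbit relation), if $t_i\ge s_i$ and $t_j\ge s_j$ then $t=s$. Unit invariance: for $a,b>0$ let $T_{a,b}$ multiply $x_i$ by $a$ and $x_j$ by $b$, leaving the other coordinates fixed. For all $a,b>0$, all $s\in\Pi_{ij}(p)\cap\mathcal S$ and all $\delta\ge0$: $X_{ij}(T_{a,b}s,a\delta)=T_{a,b}X_{ij}(s,\delta)$ and $X_{ji}(T_{a,b}s,b\delta)=T_{a,b}X_{ji}(s,\delta)$. *)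

theory Defs
  imports "HOL-Analysis.Analysis"
begin

text \<open>
  Tokens are the elements of a finite linearly ordered index type, so that states are
  vectors in \<open>real ^ 'n\<close> and the number of tokens is \<open>CARD('n)\<close>. An AMM is given by its
  output functions \<open>y i j s dx\<close>. These are only ever used for \<open>i \<noteq> j\<close> and \<open>0 \<le> dx\<close>.
\<close>

type_synonym 'n amm = "'n \<Rightarrow> 'n \<Rightarrow> real ^ 'n \<Rightarrow> real \<Rightarrow> real"

definition valid_states :: "(real ^ 'n) set" where
  "valid_states = {s. \<forall>i. s $ i > 0}"

definition swap :: "'n amm \<Rightarrow> 'n \<Rightarrow> 'n \<Rightarrow> real ^ 'n \<Rightarrow> real \<Rightarrow> real ^ 'n" where
  "swap y i j s dx =
    (\<chi> k. if k = i then s $ i + dx else if k = j then s $ j - y i j s dx else s $ k)"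

definition adjacent :: "'n amm \<Rightarrow> real ^ 'n \<Rightarrow> real ^ 'n \<Rightarrow> bool" where
  "adjacent y s t \<longleftrightarrow>
    (\<exists>i j \<delta>. i \<noteq> j \<and> \<delta> \<ge> 0 \<and> (t = swap y i j s \<delta> \<or> s = swap y i j t \<delta>))"

text \<open>Intermediate states of a chain need not be valid.\<close>

definition orbit_rel :: "'n amm \<Rightarrow> real ^ 'n \<Rightarrow> real ^ 'n \<Rightarrow> bool" where
  "orbit_rel y = (adjacent y)\<^sup>*\<^sup>*"

definition trading_orbit :: "'n amm \<Rightarrow> real ^ 'n \<Rightarrow> (real ^ 'n) set" where
  "trading_orbit y s = {t \<in> valid_states. orbit_rel y t s}"

definition coord_slice :: "'n \<Rightarrow> 'n \<Rightarrow> real ^ 'n \<Rightarrow> (real ^ 'n) set" where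
  "coord_slice i j p = {x. \<forall>k. k \<noteq> i \<and> k \<noteq> j \<longrightarrow> x $ k = p $ k}"

text \<open>
  The two-token restriction through \<open>p\<close> lives on \<open>coord_slice i j p\<close>, as a subset of the
  full state space. Its orbits are the traces of the global orbits, so chains may leave
  the slice.
\<close>

definition restricted_orbit ::
    "'n amm \<Rightarrow> 'n \<Rightarrow> 'n \<Rightarrow> real ^ 'n \<Rightarrow> real ^ 'n \<Rightarrow> (real ^ 'n) set" where
  "restricted_orbit y i j p q = trading_orbit y q \<inter> coord_slice i j p"

definition validity_invariance :: "'n amm \<Rightarrow> 'n \<Rightarrow> 'n \<Rightarrow> real ^ 'n \<Rightarrow> bool" where
  "validity_invariance y i j p \<longleftrightarrow>
    (\<forall>s \<in> coord_slice i j p. \<forall>\<delta>\<ge>0.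
      (swap y i j s \<delta> \<in> valid_states \<longleftrightarrow> s \<in> valid_states) \<and>
      (swap y j i s \<delta> \<in> valid_states \<longleftrightarrow> s \<in> valid_states))"

definition pareto_efficiency :: "'n amm \<Rightarrow> 'n \<Rightarrow> 'n \<Rightarrow> real ^ 'n \<Rightarrow> bool" where
  "pareto_efficiency y i j p \<longleftrightarrow>
    (\<forall>s \<in> coord_slice i j p \<inter> valid_states. \<forall>t \<in> restricted_orbit y i j p s.
      t $ i \<ge> s $ i \<and> t $ j \<ge> s $ j \<longrightarrow> t = s)"

definition rescale :: "'n \<Rightarrow> 'n \<Rightarrow> real \<Rightarrow> real \<Rightarrow> real ^ 'n \<Rightarrow> real ^ 'n" where
  "rescale i j a b s = (\<chi> k. if k = i then a * s $ i else if k = j then b * s $ j else s $ k)"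

definition unit_invariance :: "'n amm \<Rightarrow> 'n \<Rightarrow> 'n \<Rightarrow> real ^ 'n \<Rightarrow> bool" where
  "unit_invariance y i j p \<longleftrightarrow>
    (\<forall>a>0. \<forall>b>0. \<forall>s \<in> coord_slice i j p \<inter> valid_states. \<forall>\<delta>\<ge>0.
      swap y i j (rescale i j a b s) (a * \<delta>) = rescale i j a b (swap y i j s \<delta>) \<and>
      swap y j i (rescale i j a b s) (b * \<delta>) = rescale i j a b (swap y j i s \<delta>))"

definition two_asset_axioms :: "'n amm \<Rightarrow> 'n \<Rightarrow> 'n \<Rightarrow> real ^ 'n \<Rightarrow> bool" where
  "two_asset_axioms y i j p \<longleftrightarrow>
    validity_invariance y i j p \<and> pareto_efficiency y i j p \<and> unit_invariance y i j p"

definition permute_state :: "('n \<Rightarrow> 'n) \<Rightarrow> real ^ 'n \<Rightarrow> real ^ 'n" where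
  "permute_state \<sigma> s = (\<chi> i. s $ \<sigma> i)"

definition weighted_product :: "('n::finite \<Rightarrow> real) \<Rightarrow> real ^ 'n \<Rightarrow> real" where
  "weighted_product w x = (\<Prod>i\<in>UNIV. (x $ i) powr w i)"

definition level_sets :: "(real ^ 'n \<Rightarrow> real) \<Rightarrow> (real ^ 'n) set set" where
  "level_sets f = {{x \<in> valid_states. f x = c} | c. c \<in> f ` valid_states}"

end

theory Submission
  imports Defs
begin

text \<open>
  Two valid states are related exactly when their weighted products agree. The state with
  logarithms \<open>w j\<close> at token \<open>i\<close>, \<open>- w i\<close> at token \<open>j\<close>, and \<open>0\<close> elsewhere has the same weighted
  product as the all-ones state. Exchanging \<open>i\<close> and \<open>j\<close> must preserve this, which forces
  \<open>(w i)\<^sup>2 = (w j)\<^sup>2\<close>.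
\<close>

text \<open>The zero-length chain puts \<open>s\<close> in its own orbit, so the level that this
  orbit realizes can only be \<open>f s\<close>. This turns statements about chains of swaps into
  equations between values of \<open>f\<close>.\<close>

lemma orbit_rel_iff_of_level_sets:
  assumes "trading_orbit y ` valid_states = level_sets f"
    and "s \<in> valid_states" "t \<in> valid_states"
  shows "orbit_rel y t s \<longleftrightarrow> f t = f s"
proof -
  obtain c where c: "trading_orbit y s = {x \<in> valid_states. f x = c}"
    using assms(1,2) unfolding level_sets_def by blast
  have "s \<in> trading_orbit y s"
    using assms(2) by (simp add: trading_orbit_def orbit_rel_def)
  then have "c = f s" using c by simp
  moreover have "orbit_rel y t s \<longleftrightarrow> t \<in> trading_orbit y s"
    using assms(3) by (simp add: trading_orbit_def)
  ultimately show ?thesis using c assms(3) by simp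
qed

text \<open>In logarithmic coordinates the weighted product is linear up to an outer exponential, so
  comparing products reduces to comparing sums.\<close>

lemma weighted_product_exp:
  "weighted_product w (\<chi> k. exp (v k)) = exp (\<Sum>k\<in>UNIV. w k * v k)"
  by (simp add: weighted_product_def powr_def exp_sum)

text \<open>With equal weights, the plain product is a function of the weighted product, hence
  constant wherever the latter is.\<close>

lemma weighted_product_powr_card:
  fixes x :: "real ^ 'n"
  assumes "x \<in> valid_states"
  shows "weighted_product (\<lambda>_. 1 / real CARD('n)) x powr real CARD('n) = (\<Prod>i\<in>UNIV. x $ i)"
proof -
  have pos: "x $ i > 0" for i using assms by (simp add: valid_states_def)
  have "weighted_product (\<lambda>_. 1 / real CARD('n)) x powr real CARD('n)
      = (\<Prod>i\<in>UNIV. (x $ i powr (1 / real CARD('n))) powr real CARD('n))"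
    unfolding weighted_product_def by (rule prod_powr_distrib)
  also have "\<dots> = (\<Prod>i\<in>UNIV. x $ i)"
    using pos by (intro prod.cong refl) (simp add: powr_powr less_imp_le)
  finally show ?thesis .
qed

lemma weights_eq_of_symmetric:
  fixes w :: "'n::finite \<Rightarrow> real"
  assumes pos: "\<And>i. w i > 0"
    and sym: "\<And>\<sigma> s t. \<sigma> permutes UNIV \<Longrightarrow> s \<in> valid_states \<Longrightarrow> t \<in> valid_states \<Longrightarrow>
      weighted_product w s = weighted_product w t \<Longrightarrow>
      weighted_product w (permute_state \<sigma> s) = weighted_product w (permute_state \<sigma> t)"
  shows "w i = w j"
proof (cases "i = j")
  case False
  define \<sigma> where "\<sigma> = Transposition.transpose i j"
  define v where "v k = (if k = i then w j else 0) - (if k = j then w i else 0)" for k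
  have v_swap: "v (\<sigma> k) = (if k = j then w j else 0) - (if k = i then w i else 0)" for k
    using False by (auto simp: v_def \<sigma>_def Transposition.transpose_def)
  have "\<sigma> permutes UNIV" by (simp add: \<sigma>_def permutes_swap_id)
  \<comment> \<open>The terms \<open>w i * w j\<close> and \<open>- w j * w i\<close> cancel.
    Writing the all-ones state with \<open>exp 0\<close> lets \<open>weighted_product_exp\<close>
    rewrite both sides.\<close>
  moreover have "weighted_product w (\<chi> k. exp (v k)) = weighted_product w (\<chi> k. exp 0)"
    unfolding weighted_product_exp v_def
    by (simp add: right_diff_distrib sum_subtractf mult_delta_right)
  ultimately have "weighted_product w (permute_state \<sigma> (\<chi> k. exp (v k)))
      = weighted_product w (permute_state \<sigma> (\<chi> k. exp 0))"
    by (intro sym) (simp_all add: valid_states_def)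
  then have "weighted_product w (\<chi> k. exp (v (\<sigma> k))) = weighted_product w (\<chi> k. exp 0)"
    by (simp add: permute_state_def)
  then have "w j * w j = w i * w i"
    unfolding weighted_product_exp v_swap
    by (simp add: right_diff_distrib sum_subtractf mult_delta_right)
  \<comment> \<open>Positivity excludes the other root, \<open>w j = - w i\<close>.\<close>
  then show ?thesis
    using pos[of i] pos[of j] by (simp add: square_eq_iff)
qed simp

theorem corollary3p7:
  fixes y :: "('n::{finite,linorder}) amm" and w :: "'n \<Rightarrow> real"
  assumes "CARD('n) \<ge> 2"
    and "\<And>p i j. p \<in> valid_states \<Longrightarrow> i < j \<Longrightarrow> two_asset_axioms y i j p"
    and "\<And>\<sigma> s t. \<sigma> permutes UNIV \<Longrightarrow> s \<in> valid_states \<Longrightarrow> t \<in> valid_states \<Longrightarrow>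
      orbit_rel y s t \<longleftrightarrow> orbit_rel y (permute_state \<sigma> s) (permute_state \<sigma> t)"
    and "\<And>i. w i > 0"
    and "(\<Sum>i\<in>UNIV. w i) = 1"
    and "trading_orbit y ` valid_states = level_sets (weighted_product w)"
  shows "(\<forall>i. w i = 1 / real CARD('n)) \<and>
    (\<forall>s\<in>valid_states. (\<lambda>x. \<Prod>i\<in>UNIV. x $ i) constant_on trading_orbit y s)"
proof -
  note orbit = orbit_rel_iff_of_level_sets[OF assms(6)]
  have valid_permute: "permute_state \<sigma> s \<in> valid_states" if "s \<in> valid_states" for \<sigma> and s :: "(real, 'n) vec"
    using that by (simp add: valid_states_def permute_state_def)
  \<comment> \<open>Permuted states stay valid, so \<open>orbit\<close> applies on both sides of the
    permutation hypothesis and makes it a symmetry of the level sets.\<close>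
  have eq: "w i = w j" for i j
    by (rule weights_eq_of_symmetric[OF assms(4)]) (use assms(3) orbit valid_permute in blast)
  have w: "w i = 1 / real CARD('n)" for i
  proof -
    have "(\<Sum>k\<in>UNIV. w k) = (\<Sum>k\<in>(UNIV :: 'n set). w i)" by (intro sum.cong refl eq)
    then show ?thesis using assms(5) by (simp add: field_simps)
  qed
  then have w_const: "w = (\<lambda>_. 1 / real CARD('n))" by blast
  have "(\<lambda>x. \<Prod>i\<in>UNIV. x $ i) constant_on trading_orbit y s" if "s \<in> valid_states" for s
    unfolding constant_on_def
  proof (intro exI ballI)
    fix x assume "x \<in> trading_orbit y s"
    then have x: "x \<in> valid_states" "orbit_rel y x s" by (auto simp: trading_orbit_def)
    then have "weighted_product w x = weighted_product w s" using orbit that by blast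
    \<comment> \<open>Raise the equal weighted products to the power
      \<open>CARD('n)\<close>.\<close>
    then show "(\<Prod>i\<in>UNIV. x $ i) = (\<Prod>i\<in>UNIV. s $ i)"
      using weighted_product_powr_card x(1) that unfolding w_const by metis
  qed
  with w show ?thesis by blast
qed

end
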